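(* For all $(\xi,\eta)\in\Omega$, the functions $u,\bar u,v,\bar v,w_1,w_2,w_3,w_4$ defined in the context satisfy $$\partial_\xi u=-v\,w_4,\qquad \partial_\xi v=-u\,w_3,\qquad \partial_\xi w_1=-u\,v,$$ $$\partial_\xi \bar u=\bar v\,w_3,\qquad \partial_\xi \bar v=\bar u\,w_4,\qquad \partial_\xi w_2=\bar u\,\bar v .$$
   Context: The overbar does NOT denote complex conjugation; barred and unbarred quantities are independent. Fix $N\ge 1$ and complex constants $L_j,\bar L_j,\alpha_j,\bar\alpha_j,c_j,\bar c_j$ ($1\le j\le N$) with $L_j\ne0$, $\bar L_j\neq 0$ and $L_j\neq\bar L_k$ for all $j,k$. Put $\mathsf L=\mathrm{diag}(L_1,\dots,L_N)$, $\bar{\mathsf L}=\mathrm{diag}(\bar L_1,\dots,\bar L_N)$, columns $|\alpha\rangle=(\alpha_1,\dots,\alpha_N)^T$, $|\bar\alpha\rangle=(\bar\alpha_1,\dots,\bar\alpha_N)^T$, rows $\langle c|=(c_1,\dots,c_N)$, $\langle\bar c|=(\bar c_1,\dots,\bar c_N)$. For $(\xi,\eta)\in\mathbb C^2$ define the rows $$\langle a|=\langle c|\exp(\xi\mathsf L^{-1}-\eta\mathsf L),\qquad \langle\bar a|=\langle\bar c|\exp(-\xi\bar{\mathsf L}^{-1}+\eta\bar{\mathsf L}),$$ and the $N\times N$ matrices $$\mathsf A=\Big(\frac{\alpha_jc_k}{\bar L_j-L_k}\Big)_{j,k=1}^{N}\exp(\xi\mathsf L^{-1}-\eta\mathsf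 L),\qquad \bar{\mathsf A}=\Big(\frac{\bar\alpha_j\bar c_k}{L_j-\bar L_k}\Big)_{j,k=1}^{N}\exp(-\xi\bar{\mathsf L}^{-1}+\eta\bar{\mathsf L}),$$ which satisfy $\bar{\mathsf L}\mathsf A-\mathsf A\mathsf L=|\alpha\rangle\langle a|$ and $\mathsf L\bar{\mathsf A}-\bar{\mathsf A}\bar{\mathsf L}=|\bar\alpha\rangle\langle\bar a|$. Let $\Omega\subset\mathbb C^2$ be the open set where $\det(1+\mathsf A\bar{\mathsf A})\ne0$, and on $\Omega$ put $\mathsf G=(1+\mathsf A\bar{\mathsf A})^{-1}$, $\bar{\mathsf G}=(1+\bar{\mathsf A}\mathsf A)^{-1}$. Put $\langle b|=\langle a|\mathsf L^{-1}$, $\langle\bar b|=\langle\bar a|\bar{\mathsf L}^{-1}$, $|\beta\rangle=\bar{\mathsf L}^{-1}|\alpha\rangle$, $|\bar\beta\rangle=\mathsf L^{-1}|\bar\alpha\rangle$. Define the scalar functions on $\Omega$ $$u=1-\langle\bar a|\mathsf G\mathsf A|\bar\beta\rangle,\quad v=\langle\bar a|\mathsf G|\beta\rangle,\quad \bar u=1-\langle a|\bar{\mathsf G}\bar{\mathsf A}|\beta\rangle,\quad \bar v=\langle a|\bar{\mathsf G}|\bar\beta\rangle,$$ $$w_1=\langle\bar a|\mathsf G|\alpha\rangle,\quad w_2=\langle a|\bar{\mathsf G}|\bar\alpha\rangle,\quad w_3=\langle\bar b|\mathsf G|\beta\rangle,\quad w_4=\langle b|\bar{\mathsf G}|\bar\beta\rangle.$$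 $\partial_\xi,\partial_\eta$ are (holomorphic) partial derivatives. *)

theory Defs
  imports "HOL-Analysis.Analysis"
begin

text \<open>
  A trailing \<open>b\<close> in a name stands for the overbar. It is not complex conjugation: the barred and
  unbarred constants are independent. The index type \<open>'n\<close> has \<open>CARD('n) = N \<ge> 1\<close> elements, and
  both rows and columns of length \<open>N\<close> have type \<open>complex^'n\<close>.
\<close>

definition diag :: "complex^'n \<Rightarrow> complex^'n^'n" where
  "diag x = (\<chi> i j. if i = j then x $ i else 0)"

text \<open>
  The type \<open>complex^'n^'n\<close> carries the componentwise product, so neither \<open>exp\<close> nor \<open>(^)\<close> is the
  matrix operation.
\<close>

definition matpow :: "complex^'n^'n \<Rightarrow> nat \<Rightarrow> complex^'n^'n" where
  "matpow M k = (((**) M) ^^ k) (mat 1)"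

definition mat_exp :: "complex^'n^'n \<Rightarrow> complex^'n^'n" where
  "mat_exp M = (\<Sum>k. matpow M k /\<^sub>R fact k)"

text \<open>The product of a row, a matrix and a column, bilinear over the complex numbers.\<close>

definition bracket :: "complex^'n \<Rightarrow> complex^'n^'n \<Rightarrow> complex^'n \<Rightarrow> complex" where
  "bracket x M y = (\<Sum>i\<in>UNIV. x $ i * (M *v y) $ i)"

text \<open>
  The fields are the constants \<open>L\<^sub>j, \<alpha>\<^sub>j, c\<^sub>j\<close> and their barred counterparts. The conditions that
  \<open>L\<^sub>j\<close> and its barred counterpart are nonzero and that no \<open>L\<^sub>j\<close> equals a barred one are not part of
  the record and have to be assumed where they are needed.
\<close>

record ('n::finite) soliton_data =
  lam :: "complex^'n"
  lamb :: "complex^'n"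
  alpha :: "complex^'n"
  alphab :: "complex^'n"
  cc :: "complex^'n"
  ccb :: "complex^'n"

definition matL :: "('n::finite) soliton_data \<Rightarrow> complex^'n^'n" where
  "matL p = diag (lam p)"

definition matLb :: "('n::finite) soliton_data \<Rightarrow> complex^'n^'n" where
  "matLb p = diag (lamb p)"

text \<open>\<open>mat z\<close> is \<open>z\<close> times the identity, so \<open>mat z ** M\<close> is the scalar multiple \<open>z M\<close>.\<close>

definition phase :: "('n::finite) soliton_data \<Rightarrow> complex \<Rightarrow> complex \<Rightarrow> complex^'n^'n" where
  "phase p \<xi> \<eta> = mat_exp (mat \<xi> ** matrix_inv (matL p) - mat \<eta> ** matL p)"

definition phaseb :: "('n::finite) soliton_data \<Rightarrow> complex \<Rightarrow> complex \<Rightarrow> complex^'n^'n" where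
  "phaseb p \<xi> \<eta> = mat_exp (- (mat \<xi> ** matrix_inv (matLb p)) + mat \<eta> ** matLb p)"

definition row_a :: "('n::finite) soliton_data \<Rightarrow> complex \<Rightarrow> complex \<Rightarrow> complex^'n" where
  "row_a p \<xi> \<eta> = cc p v* phase p \<xi> \<eta>"

definition row_ab :: "('n::finite) soliton_data \<Rightarrow> complex \<Rightarrow> complex \<Rightarrow> complex^'n" where
  "row_ab p \<xi> \<eta> = ccb p v* phaseb p \<xi> \<eta>"

definition matA :: "('n::finite) soliton_data \<Rightarrow> complex \<Rightarrow> complex \<Rightarrow> complex^'n^'n" where
  "matA p \<xi> \<eta> =
     (\<chi> j k. alpha p $ j * cc p $ k / (lamb p $ j - lam p $ k)) ** phase p \<xi> \<eta>"

definition matAb :: "('n::finite) soliton_data \<Rightarrow> complex \<Rightarrow> complex \<Rightarrow> complex^'n^'n" where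
  "matAb p \<xi> \<eta> =
     (\<chi> j k. alphab p $ j * ccb p $ k / (lam p $ j - lamb p $ k)) ** phaseb p \<xi> \<eta>"

definition Omega :: "('n::finite) soliton_data \<Rightarrow> (complex \<times> complex) set" where
  "Omega p = {(\<xi>, \<eta>). det (mat 1 + matA p \<xi> \<eta> ** matAb p \<xi> \<eta>) \<noteq> 0}"

definition matG :: "('n::finite) soliton_data \<Rightarrow> complex \<Rightarrow> complex \<Rightarrow> complex^'n^'n" where
  "matG p \<xi> \<eta> = matrix_inv (mat 1 + matA p \<xi> \<eta> ** matAb p \<xi> \<eta>)"

definition matGb :: "('n::finite) soliton_data \<Rightarrow> complex \<Rightarrow> complex \<Rightarrow> complex^'n^'n" where
  "matGb p \<xi> \<eta> = matrix_inv (mat 1 + matAb p \<xi> \<eta> ** matA p \<xi> \<eta>)"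

definition row_b :: "('n::finite) soliton_data \<Rightarrow> complex \<Rightarrow> complex \<Rightarrow> complex^'n" where
  "row_b p \<xi> \<eta> = row_a p \<xi> \<eta> v* matrix_inv (matL p)"

definition row_bb :: "('n::finite) soliton_data \<Rightarrow> complex \<Rightarrow> complex \<Rightarrow> complex^'n" where
  "row_bb p \<xi> \<eta> = row_ab p \<xi> \<eta> v* matrix_inv (matLb p)"

definition beta :: "('n::finite) soliton_data \<Rightarrow> complex^'n" where
  "beta p = matrix_inv (matLb p) *v alpha p"

definition betab :: "('n::finite) soliton_data \<Rightarrow> complex^'n" where
  "betab p = matrix_inv (matL p) *v alphab p"

definition u :: "('n::finite) soliton_data \<Rightarrow> complex \<Rightarrow> complex \<Rightarrow> complex" where
  "u p \<xi> \<eta> = 1 - bracket (row_ab p \<xi> \<eta>) (matG p \<xi> \<eta> ** matA p \<xi> \<eta>) (betab p)"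

definition v :: "('n::finite) soliton_data \<Rightarrow> complex \<Rightarrow> complex \<Rightarrow> complex" where
  "v p \<xi> \<eta> = bracket (row_ab p \<xi> \<eta>) (matG p \<xi> \<eta>) (beta p)"

definition ub :: "('n::finite) soliton_data \<Rightarrow> complex \<Rightarrow> complex \<Rightarrow> complex" where
  "ub p \<xi> \<eta> = 1 - bracket (row_a p \<xi> \<eta>) (matGb p \<xi> \<eta> ** matAb p \<xi> \<eta>) (beta p)"

definition vb :: "('n::finite) soliton_data \<Rightarrow> complex \<Rightarrow> complex \<Rightarrow> complex" where
  "vb p \<xi> \<eta> = bracket (row_a p \<xi> \<eta>) (matGb p \<xi> \<eta>) (betab p)"

definition w1 :: "('n::finite) soliton_data \<Rightarrow> complex \<Rightarrow> complex \<Rightarrow> complex" where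
  "w1 p \<xi> \<eta> = bracket (row_ab p \<xi> \<eta>) (matG p \<xi> \<eta>) (alpha p)"

definition w2 :: "('n::finite) soliton_data \<Rightarrow> complex \<Rightarrow> complex \<Rightarrow> complex" where
  "w2 p \<xi> \<eta> = bracket (row_a p \<xi> \<eta>) (matGb p \<xi> \<eta>) (alphab p)"

definition w3 :: "('n::finite) soliton_data \<Rightarrow> complex \<Rightarrow> complex \<Rightarrow> complex" where
  "w3 p \<xi> \<eta> = bracket (row_bb p \<xi> \<eta>) (matG p \<xi> \<eta>) (beta p)"

definition w4 :: "('n::finite) soliton_data \<Rightarrow> complex \<Rightarrow> complex \<Rightarrow> complex" where
  "w4 p \<xi> \<eta> = bracket (row_b p \<xi> \<eta>) (matGb p \<xi> \<eta>) (betab p)"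

lemma diag_mult: "diag x ** diag y = diag (\<chi> i. x $ i * y $ i)"
proof -
  have "(\<Sum>k\<in>UNIV. diag x $ i $ k * diag y $ k $ j) = (if i = j then x $ i * y $ i else 0)" for i j
  proof -
    have "(\<Sum>k\<in>UNIV. diag x $ i $ k * diag y $ k $ j)
        = (\<Sum>k\<in>UNIV. if k = i then x $ i * diag y $ i $ j else 0)"
      by (intro sum.cong) (auto simp: diag_def)
    then show ?thesis by (simp add: diag_def)
  qed
  then show ?thesis
    by (simp add: vec_eq_iff matrix_matrix_mult_def) (simp add: diag_def)
qed

lemma matpow_diag: "matpow (diag x) k = diag (\<chi> i. (x $ i) ^ k)"
proof (induction k)
  case 0
  show ?case by (simp add: matpow_def diag_def mat_def vec_eq_iff)
next
  case (Suc k)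
  have "matpow (diag x) (Suc k) = diag x ** matpow (diag x) k"
    by (simp add: matpow_def)
  then show ?case
    by (simp add: Suc.IH diag_mult)
qed

lemma mat_exp_diag: "mat_exp (diag x) = diag (\<chi> i. exp (x $ i))"
proof -
  have "(\<lambda>k. matpow (diag x) k /\<^sub>R fact k) sums diag (\<chi> i. exp (x $ i))"
    unfolding sums_def matpow_diag
  proof (intro vec_tendstoI)
    fix i j
    show "(\<lambda>n. (\<Sum>k<n. diag (\<chi> i. (x $ i) ^ k) /\<^sub>R fact k) $ i $ j)
            \<longlonglongrightarrow> diag (\<chi> i. exp (x $ i)) $ i $ j"
      using exp_converges[of "x $ i"]
      by (cases "i = j") (simp_all add: diag_def sums_def)
  qed
  then show ?thesis
    unfolding mat_exp_def by (simp add: sums_iff)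
qed

end

theory Submission
  imports Defs
begin

text \<open>
  With \<open>K = L\<^sup>-\<^sup>1\<close> and \<open>Kb = Lb\<^sup>-\<^sup>1\<close> the Sylvester equations read \<open>A K = Kb A + |\<beta>\<rangle>\<langle>b|\<close> and
  \<open>Ab Kb = K Ab + |\<beta>b\<rangle>\<langle>bb|\<close>. Hence the \<open>\<xi>\<close>-derivative of \<open>A Ab\<close> collapses to the rank one matrix
  \<open>- A |\<beta>b\<rangle>\<langle>bb|\<close>, which gives the derivative of \<open>v\<close>, and \<open>Kb G - G Kb\<close> is a sum of two rank one
  matrices, which gives the derivative of \<open>u\<close>. For \<open>w1\<close> one also needs
  \<open>u = 1 + \<langle>b|Ab G|\<alpha>\<rangle>\<close>, which comes from writing both sides as determinants by the matrix determinant
  lemma. Exchanging barred and unbarred data while negating \<open>\<xi>\<close> and \<open>\<eta>\<close> maps the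
  problem to itself and yields the other three equations.
\<close>

section \<open>Bilinear brackets and rank one matrices\<close>

definition outer :: "'a::comm_ring_1^'n \<Rightarrow> 'a^'m \<Rightarrow> 'a^'m^'n" where
  "outer x y = (\<chi> i j. x $ i * y $ j)"

lemma matrix_add_rdistrib: "((B + C) ** A) = (B ** A) + (C ** (A :: 'a::semiring_1^_^_))"
  by (vector matrix_matrix_mult_def sum.distrib[symmetric] field_simps)

lemma matrix_diff_ldistrib: "A ** (B - C) = A ** B - A ** (C :: 'a::ring_1^_^_)"
  by (vector matrix_matrix_mult_def sum_subtractf[symmetric] algebra_simps)

lemma matrix_diff_rdistrib: "(B - C) ** A = B ** A - C ** (A :: 'a::ring_1^_^_)"
  by (vector matrix_matrix_mult_def sum_subtractf[symmetric] algebra_simps)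

lemma matrix_minus_left: "(- A) ** B = - (A ** (B :: 'a::ring_1^_^_))"
  by (vector matrix_matrix_mult_def sum_negf)

lemma matrix_minus_right: "A ** (- B) = - (A ** (B :: 'a::ring_1^_^_))"
  by (vector matrix_matrix_mult_def sum_negf)

lemmas matrix_distribs = matrix_add_ldistrib matrix_add_rdistrib matrix_diff_ldistrib
  matrix_diff_rdistrib matrix_minus_left matrix_minus_right matrix_mul_assoc

lemma bracket_eq: "bracket x M y = (\<Sum>i\<in>UNIV. \<Sum>j\<in>UNIV. x $ i * M $ i $ j * y $ j)"
  by (simp add: bracket_def matrix_vector_mult_def sum_distrib_left mult.assoc)

lemma bracket_eq_row: "bracket x M y = (\<Sum>j\<in>UNIV. (x v* M) $ j * y $ j)"
  unfolding bracket_eq vector_matrix_mult_def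
  by (subst sum.swap) (simp add: sum_distrib_left mult_ac)

lemma bracket_linear:
  "bracket x (M + M') y = bracket x M y + bracket x M' y"
  "bracket x (M - M') y = bracket x M y - bracket x M' y"
  "bracket x (- M) y = - bracket x M y"
  "bracket (- x) M y = - bracket x M y"
  by (simp_all add: bracket_eq algebra_simps sum.distrib sum_subtractf sum_negf)

lemma bracket_vector_matrix: "bracket (x v* K) M y = bracket x (K ** M) y"
  by (simp add: bracket_eq_row vector_matrix_mul_assoc)

lemma bracket_matrix_vector: "bracket x M (K *v y) = bracket x (M ** K) y"
  by (simp add: bracket_def matrix_vector_mul_assoc)

lemma matrix_outer: "P ** outer x y = outer (P *v x) y"
  by (simp add: outer_def matrix_matrix_mult_def matrix_vector_mult_def vec_eq_iff
      sum_distrib_right mult.assoc)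

lemma outer_matrix: "outer x y ** Q = outer x (y v* Q)"
  by (simp add: outer_def matrix_matrix_mult_def vector_matrix_mult_def vec_eq_iff
      sum_distrib_left mult_ac)

lemma bracket_one: "bracket x (mat 1) y = (\<Sum>i\<in>UNIV. x $ i * y $ i)"
  by (simp add: bracket_def)

lemma bracket_outer: "bracket r (outer x y) s = bracket r (mat 1) x * bracket y (mat 1) s"
  unfolding bracket_one by (simp add: bracket_eq outer_def sum_product mult.assoc)

text \<open>A rank one factor cuts the chain of matrices in two. Every product of two scalar fields
  in the final equations arises from such a cut.\<close>

lemma bracket_outer_mult: "bracket r (P ** outer x y ** Q) s = bracket r P x * bracket y Q s"
  by (simp add: matrix_outer outer_matrix bracket_outer bracket_vector_matrix bracket_matrix_vector)

lemma bracket_outer_mult_end: "bracket r (P ** outer x y) s = bracket r P x * bracket y (mat 1) s"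
  using bracket_outer_mult[of r P x y "mat 1" s] by simp

section \<open>The matrix determinant lemma\<close>

text \<open>Subtracting \<open>x $ i\<close> times row \<open>k\<close> from row \<open>i\<close>
  removes \<open>y\<close> from the rows in \<open>S\<close>. The induction undoes one such row
  operation at a time.\<close>

lemma det_replace_row:
  fixes x y :: "'a::field^'n" and S :: "'n set"
  assumes "finite S" "k \<notin> S"
  shows "det (\<chi> i. if i = k then y else if i \<in> S then axis i 1 + x $ i *s y else axis i 1) = y $ k"
  using assms
proof (induction S)
  case empty
  \<comment> \<open>Base case: \<open>y\<close> is expanded in the unit vectors, which are the rows
    of the identity, so that Cramer's lemma for rows reads off its coefficient at
    \<open>k\<close>.\<close>
  have "row i (mat 1 :: 'a^'n^'n) = axis i 1" for i :: 'n
    by (simp add: row_def mat_def axis_def vec_eq_iff eq_commute)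
  moreover have "(\<Sum>i\<in>UNIV. y $ i *s axis i 1) = y"
    by (simp add: vec_eq_iff axis_def if_distrib cong: if_cong)
  ultimately show ?case
    using cramer_lemma_transpose[of k y "mat 1"]
    by (simp only: empty_iff if_False det_I mult_1_right)
next
  case (insert j S)
  let ?A = "\<chi> i. if i = k then y else if i \<in> S then axis i 1 + x $ i *s y else axis i 1"
  have split: "(\<chi> i. if i = k then y else if i \<in> insert j S then axis i 1 + x $ i *s y else axis i 1)
      = (\<chi> i. if i = j then row j ?A + x $ j *s row k ?A else row i ?A)"
    unfolding row_def vec_lambda_eta using insert by (intro arg_cong[of _ _ vec_lambda] ext) simp
  have op: "det (\<chi> i. if i = j then row j ?A + x $ j *s row k ?A else row i ?A) = det ?A"
    using insert by (intro det_row_operation) auto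
  show ?case
    unfolding split op using insert by blast
qed

text \<open>The rank one term is added row by row. By linearity in row \<open>k\<close>, the part
  \<open>axis k 1\<close> reproduces the determinant for \<open>S\<close>, and the part
  \<open>x $ k *s y\<close> contributes \<open>x $ k * y $ k\<close> by
  \<open>det_replace_row\<close>.\<close>

lemma det_one_plus_outer_aux:
  fixes x y :: "'a::field^'n" and S :: "'n set"
  assumes "finite S"
  shows "det (\<chi> i. if i \<in> S then axis i 1 + x $ i *s y else axis i 1) = 1 + (\<Sum>i\<in>S. x $ i * y $ i)"
  using assms
proof (induction S)
  case empty
  have "(\<chi> i. axis i 1) = (mat 1 :: 'a^'n^'n)"
    by (simp add: mat_def axis_def vec_eq_iff eq_commute)
  then show ?case by simp
next
  case (insert k S)
  let ?R = "\<lambda>i. if i \<in> S then axis i 1 + x $ i *s y else axis i 1 :: 'a^'n"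
  have split: "(\<chi> i. if i \<in> insert k S then axis i 1 + x $ i *s y else axis i 1)
      = (\<chi> i. if i = k then axis i 1 + x $ k *s y else ?R i)"
    by (intro arg_cong[of _ _ vec_lambda] ext) simp
  have old: "(\<chi> i. if i = k then axis i 1 else ?R i) = (\<chi> i. ?R i)"
    using insert by (intro arg_cong[of _ _ vec_lambda] ext) simp
  have new: "det (\<chi> i. if i = k then x $ k *s y else ?R i) = x $ k * y $ k"
    using insert by (subst det_row_mul) (simp add: det_replace_row)
  show ?case
    unfolding split det_row_add old new using insert by (simp add: add_ac)
qed

lemma det_one_plus_outer:
  fixes x y :: "'a::field^'n"
  shows "det (mat 1 + outer x y) = 1 + (\<Sum>i\<in>UNIV. x $ i * y $ i)"
proof -
  have "mat 1 + outer x y = (\<chi> i. axis i 1 + x $ i *s y)"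
    by (simp add: outer_def mat_def axis_def vec_eq_iff eq_commute)
  then show ?thesis
    using det_one_plus_outer_aux[of UNIV x y] by simp
qed

lemma det_one_plus_outer_bracket:
  "det (mat 1 + outer (P *v x) y) = 1 + bracket y P x"
  by (simp add: det_one_plus_outer bracket_def mult.commute)

section \<open>Entrywise derivatives of matrix functions\<close>

text \<open>\<open>has_field_derivative\<close> concerns maps from a field to itself, so complex
  differentiation of a matrix function is expressed through its entries.\<close>

definition has_matrix_derivative :: "(complex \<Rightarrow> complex^'n^'m) \<Rightarrow> complex^'n^'m \<Rightarrow> complex \<Rightarrow> bool" where
  "has_matrix_derivative F D z \<longleftrightarrow>
    (\<forall>i j. ((\<lambda>x. F x $ i $ j) has_field_derivative D $ i $ j) (at z))"

definition has_row_derivative :: "(complex \<Rightarrow> complex^'n) \<Rightarrow> complex^'n \<Rightarrow> complex \<Rightarrow> bool" where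
  "has_row_derivative f d z \<longleftrightarrow> (\<forall>i. ((\<lambda>x. f x $ i) has_field_derivative d $ i) (at z))"

lemma has_matrix_derivative_mult:
  assumes "has_matrix_derivative F D z" "has_matrix_derivative G E z"
  shows "has_matrix_derivative (\<lambda>x. F x ** G x) (D ** G z + F z ** E) z"
  using assms unfolding has_matrix_derivative_def matrix_matrix_mult_def
  by (auto intro!: derivative_eq_intros simp: sum.distrib[symmetric] algebra_simps)

lemma has_matrix_derivative_const_add:
  assumes "has_matrix_derivative F D z"
  shows "has_matrix_derivative (\<lambda>x. C + F x) D z"
  using assms unfolding has_matrix_derivative_def
  by (auto intro!: derivative_eq_intros)

lemma has_field_derivative_bracket:
  assumes "has_row_derivative f d z" "has_matrix_derivative F D z"
  shows "((\<lambda>x. bracket (f x) (F x) y) has_field_derivative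
           bracket d (F z) y + bracket (f z) D y) (at z)"
  using assms unfolding has_matrix_derivative_def has_row_derivative_def bracket_eq
  by (auto intro!: derivative_eq_intros simp: sum.distrib[symmetric] algebra_simps)

text \<open>By the Leibniz expansion the determinant is a polynomial in the entries.\<close>

lemma field_differentiable_det:
  fixes F :: "complex \<Rightarrow> complex^'n^'n"
  assumes "\<And>i j. (\<lambda>x. F x $ i $ j) field_differentiable at z"
  shows "(\<lambda>x. det (F x)) field_differentiable at z"
proof -
  obtain e where "\<And>i j. ((\<lambda>x. F x $ i $ j) has_field_derivative e i j) (at z)"
    using assms unfolding field_differentiable_def by metis
  then have "(\<lambda>x. \<Prod>i\<in>UNIV. F x $ i $ q i) field_differentiable at z" for q
    unfolding field_differentiable_def by (intro exI) (rule has_field_derivative_prod)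
  then show ?thesis
    unfolding det_def by (intro derivative_intros)
qed

section \<open>Inverse matrices and their derivatives\<close>

lemma matrix_inv_inverse:
  fixes A :: "'a::field^'n^'n"
  assumes "det A \<noteq> 0"
  shows "A ** matrix_inv A = mat 1" "matrix_inv A ** A = mat 1"
  using assms someI_ex[of "\<lambda>B. A ** B = mat 1 \<and> B ** A = mat 1"]
  unfolding invertible_det_nz[symmetric] invertible_def matrix_inv_def by auto

lemma matrix_inv_eqI:
  fixes A B :: "'a::field^'n^'n"
  assumes "A ** B = mat 1"
  shows "matrix_inv A = B"
proof -
  have "det A \<noteq> 0"
    using assms by (metis det_I det_mul mult_zero_left zero_neq_one)
  then have "matrix_inv A ** (A ** B) = B"
    by (simp add: matrix_mul_assoc matrix_inv_inverse)
  then show ?thesis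
    by (simp add: assms)
qed

text \<open>Cramer's rule for the \<open>j\<close>-th column of the inverse. It makes each entry a
  quotient of determinants, whose differentiability is accessible.\<close>

lemma matrix_inv_nth:
  fixes A :: "'a::field^'n^'n"
  assumes "det A \<noteq> 0"
  shows "matrix_inv A $ i $ j = det (\<chi> r s. if s = i then axis j 1 $ r else A $ r $ s) / det A"
proof -
  have "A *v (matrix_inv A *v axis j 1) = axis j 1"
    using assms by (simp add: matrix_vector_mul_assoc matrix_inv_inverse)
  then have "matrix_inv A *v axis j 1 = (\<chi> i. det (\<chi> r s. if s = i then axis j 1 $ r else A $ r $ s) / det A)"
    using assms by (simp add: cramer)
  moreover have "(matrix_inv A *v axis j 1) $ i = matrix_inv A $ i $ j"
    by (simp add: matrix_vector_mult_def axis_def if_distrib cong: if_cong)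
  ultimately show ?thesis by simp
qed

text \<open>Cramer's rule first shows that some derivative exists; differentiating the product of
  the inverse with \<open>F\<close> then determines it.\<close>

lemma has_matrix_derivative_matrix_inv:
  fixes F :: "complex \<Rightarrow> complex^'n^'n"
  assumes F: "has_matrix_derivative F D z" and det: "det (F z) \<noteq> 0"
  shows "has_matrix_derivative (\<lambda>x. matrix_inv (F x)) (- (matrix_inv (F z) ** D ** matrix_inv (F z))) z"
proof -
  have diff: "(\<lambda>x. F x $ i $ j) field_differentiable at z" for i j
    using F unfolding has_matrix_derivative_def field_differentiable_def by blast
  then have diff_det: "(\<lambda>x. det (F x)) field_differentiable at z"
    by (rule field_differentiable_det)
  have "isCont (\<lambda>x. det (F x)) z"
    using diff_det by (simp add: field_differentiable_imp_continuous_at)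
  \<comment> \<open>Cramer's formula and the inverse property hold only where the determinant is
    nonzero; by continuity this is a whole neighbourhood of \<open>z\<close>, which suffices for
    derivatives.\<close>
  then have ev: "\<forall>\<^sub>F x in nhds z. det (F x) \<noteq> 0"
    using det tendsto_imp_eventually_ne[of "\<lambda>x. det (F x)"]
    by (auto simp: isCont_def eventually_nhds_conv_at)
  have "(\<lambda>x. matrix_inv (F x) $ i $ j) field_differentiable at z" for i j
  proof -
    let ?q = "\<lambda>x. det (\<chi> r s. if s = i then axis j 1 $ r else F x $ r $ s) / det (F x)"
    have "(\<lambda>x. (\<chi> r s. if s = i then axis j 1 $ r else F x $ r $ s) $ r' $ s') field_differentiable at z"
      for r' s'
      by (cases "s' = i") (simp_all add: diff)
    then have "?q field_differentiable at z"
      by (intro field_differentiable_divide[OF field_differentiable_det diff_det det])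
    then obtain d where d: "(?q has_field_derivative d) (at z)"
      unfolding field_differentiable_def by blast
    have "\<forall>\<^sub>F x in nhds z. matrix_inv (F x) $ i $ j = ?q x"
      using ev by eventually_elim (rule matrix_inv_nth)
    from DERIV_cong_ev[OF refl this refl, THEN iffD2, OF d]
    have "((\<lambda>x. matrix_inv (F x) $ i $ j) has_field_derivative d) (at z)" .
    then show ?thesis
      unfolding field_differentiable_def by blast
  qed
  then have "\<forall>i j. \<exists>e. ((\<lambda>x. matrix_inv (F x) $ i $ j) has_field_derivative e) (at z)"
    unfolding field_differentiable_def by blast
  then obtain e where e: "\<And>i j. ((\<lambda>x. matrix_inv (F x) $ i $ j) has_field_derivative e i j) (at z)"
    by metis
  define E where "E = (\<chi> i j. e i j)"
  have E: "has_matrix_derivative (\<lambda>x. matrix_inv (F x)) E z"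
    using e by (simp add: has_matrix_derivative_def E_def)
  have prod: "has_matrix_derivative (\<lambda>x. matrix_inv (F x) ** F x) (E ** F z + matrix_inv (F z) ** D) z"
    by (rule has_matrix_derivative_mult[OF E F])
  \<comment> \<open>The product is the identity matrix near \<open>z\<close>, so its derivative
    vanishes.\<close>
  have "E ** F z + matrix_inv (F z) ** D = 0"
    unfolding vec_eq_iff
  proof (intro allI)
    fix i j
    have d: "((\<lambda>x. (matrix_inv (F x) ** F x) $ i $ j) has_field_derivative
        (E ** F z + matrix_inv (F z) ** D) $ i $ j) (at z)"
      using prod by (simp add: has_matrix_derivative_def)
    have "\<forall>\<^sub>F x in nhds z. (matrix_inv (F x) ** F x) $ i $ j = (mat 1 :: complex^'n^'n) $ i $ j"
      using ev by eventually_elim (simp add: matrix_inv_inverse)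
    from DERIV_cong_ev[OF refl this refl, THEN iffD1, OF d]
    have "((\<lambda>x. (mat 1 :: complex^'n^'n) $ i $ j) has_field_derivative
        (E ** F z + matrix_inv (F z) ** D) $ i $ j) (at z)" .
    then show "(E ** F z + matrix_inv (F z) ** D) $ i $ j = 0 $ i $ j"
      by (metis DERIV_const DERIV_unique zero_index)
  qed
  then have "(E ** F z + matrix_inv (F z) ** D) ** matrix_inv (F z) = 0"
    by simp
  then have "E + matrix_inv (F z) ** D ** matrix_inv (F z) = 0"
    using det by (simp add: matrix_add_rdistrib matrix_mul_assoc[symmetric] matrix_inv_inverse)
  then have "E = - (matrix_inv (F z) ** D ** matrix_inv (F z))"
    by (simp add: eq_neg_iff_add_eq_0)
  with E show ?thesis by simp
qed

section \<open>The soliton matrices\<close>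

lemma diag_nth:
  "(diag x ** M) $ i $ j = x $ i * M $ i $ j"
  "(M ** diag x) $ i $ j = M $ i $ j * x $ j"
  "(diag x *v y) $ i = x $ i * y $ i"
  "(y v* diag x) $ i = y $ i * x $ i"
  by (simp_all add: diag_def matrix_matrix_mult_def matrix_vector_mult_def vector_matrix_mult_def
      if_distrib[of "\<lambda>t. t * _"] if_distrib[of "\<lambda>t. _ * t"] cong: if_cong)

lemma mat_eq_diag: "mat z = diag (\<chi> i. z)"
  by (simp add: mat_def diag_def vec_eq_iff)

lemma matrix_inv_diag:
  assumes "\<forall>i. x $ i \<noteq> 0"
  shows "matrix_inv (diag x) = diag (\<chi> i. inverse (x $ i))"
  using assms by (intro matrix_inv_eqI) (simp add: diag_mult mat_eq_diag)

lemma mat_exp_inv_diag: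
  assumes "\<forall>i. x $ i \<noteq> 0"
  shows "mat_exp (mat s ** matrix_inv (diag x) - mat t ** diag x)
    = diag (\<chi> i. exp (s * inverse (x $ i) - t * x $ i))"
proof -
  have "mat s ** matrix_inv (diag x) - mat t ** diag x = diag (\<chi> i. s * inverse (x $ i) - t * x $ i)"
    using assms by (simp add: matrix_inv_diag mat_eq_diag diag_mult) (simp add: diag_def vec_eq_iff)
  then show ?thesis
    by (simp add: mat_exp_diag)
qed

section \<open>Exchange of barred and unbarred data\<close>

definition swap_bar :: "('n::finite) soliton_data \<Rightarrow> 'n soliton_data" where
  "swap_bar p = \<lparr>lam = lamb p, lamb = lam p, alpha = alphab p, alphab = alpha p, cc = ccb p, ccb = cc p\<rparr>"

lemma swap_bar_sel [simp]:
  "lam (swap_bar p) = lamb p" "lamb (swap_bar p) = lam p"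
  "alpha (swap_bar p) = alphab p" "alphab (swap_bar p) = alpha p"
  "cc (swap_bar p) = ccb p" "ccb (swap_bar p) = cc p"
  by (simp_all add: swap_bar_def)

lemma mat_uminus: "mat (- z) = - mat (z :: 'a::ring_1)"
  by (simp add: mat_def vec_eq_iff)

text \<open>The two exponents have opposite signs, so the exchange must be paired with negating
  \<xi> and \<eta>.\<close>

lemma phase_swap_bar:
  "phase (swap_bar p) (- \<xi>) (- \<eta>) = phaseb p \<xi> \<eta>"
  "phaseb (swap_bar p) (- \<xi>) (- \<eta>) = phase p \<xi> \<eta>"
  by (simp_all add: phase_def phaseb_def matL_def matLb_def mat_uminus matrix_minus_left)

lemma fields_swap_bar:
  "matA (swap_bar p) (- \<xi>) (- \<eta>) = matAb p \<xi> \<eta>"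
  "matAb (swap_bar p) (- \<xi>) (- \<eta>) = matA p \<xi> \<eta>"
  "u (swap_bar p) (- \<xi>) (- \<eta>) = ub p \<xi> \<eta>"
  "v (swap_bar p) (- \<xi>) (- \<eta>) = vb p \<xi> \<eta>"
  "w1 (swap_bar p) (- \<xi>) (- \<eta>) = w2 p \<xi> \<eta>"
  "w3 (swap_bar p) (- \<xi>) (- \<eta>) = w4 p \<xi> \<eta>"
  "w4 (swap_bar p) (- \<xi>) (- \<eta>) = w3 p \<xi> \<eta>"
  by (simp_all add: u_def ub_def v_def vb_def w1_def w2_def w3_def w4_def matG_def matGb_def
      matA_def matAb_def row_a_def row_ab_def row_b_def row_bb_def beta_def betab_def
      phase_swap_bar matL_def matLb_def)

section \<open>Matrix identities at a fixed point of \<open>Omega\<close>\<close>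

locale soliton_point =
  fixes p :: "('n::finite) soliton_data" and \<xi> \<eta> :: complex
  assumes lam_nz: "\<forall>j. lam p $ j \<noteq> 0"
    and lamb_nz: "\<forall>j. lamb p $ j \<noteq> 0"
    and lam_lamb: "\<forall>j k. lam p $ j \<noteq> lamb p $ k"
    and in_Omega: "(\<xi>, \<eta>) \<in> Omega p"
begin

abbreviation "A \<equiv> matA p \<xi> \<eta>"
abbreviation "Ab \<equiv> matAb p \<xi> \<eta>"
abbreviation "G \<equiv> matG p \<xi> \<eta>"
abbreviation "Gb \<equiv> matGb p \<xi> \<eta>"
abbreviation "K \<equiv> matrix_inv (matL p)"
abbreviation "Kb \<equiv> matrix_inv (matLb p)"
abbreviation "a \<equiv> row_a p \<xi> \<eta>"
abbreviation "ab \<equiv> row_ab p \<xi> \<eta>"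
abbreviation "b \<equiv> row_b p \<xi> \<eta>"
abbreviation "bb \<equiv> row_bb p \<xi> \<eta>"

lemma lamb_lam: "lamb p $ j \<noteq> lam p $ k"
  using lam_lamb by metis

lemma K_eq: "K = diag (\<chi> i. inverse (lam p $ i))" "Kb = diag (\<chi> i. inverse (lamb p $ i))"
  using lam_nz lamb_nz by (simp_all add: matL_def matLb_def matrix_inv_diag)

text \<open>Stated for arbitrary \<open>x\<close> and \<open>y\<close> rather than at the fixed
  point, since the phases are later differentiated in \<open>x\<close>.\<close>

lemma phase_eq:
  "phase p x y = diag (\<chi> i. exp (x * inverse (lam p $ i) - y * lam p $ i))"
  "phaseb p x y = diag (\<chi> i. exp (y * lamb p $ i - x * inverse (lamb p $ i)))"
proof -
  show "phase p x y = diag (\<chi> i. exp (x * inverse (lam p $ i) - y * lam p $ i))"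
    unfolding phase_def matL_def using lam_nz by (rule mat_exp_inv_diag)
  have "phaseb p x y = phase (swap_bar p) (- x) (- y)"
    by (simp add: phase_swap_bar)
  also have "\<dots> = diag (\<chi> i. exp ((- x) * inverse (lamb p $ i) - (- y) * lamb p $ i))"
    unfolding phase_def matL_def swap_bar_sel using lamb_nz by (rule mat_exp_inv_diag)
  finally show "phaseb p x y = diag (\<chi> i. exp (y * lamb p $ i - x * inverse (lamb p $ i)))"
    by simp
qed

lemma det_G: "det (mat 1 + A ** Ab) \<noteq> 0"
  using in_Omega by (simp add: Omega_def)

lemma G_inverse: "(mat 1 + A ** Ab) ** G = mat 1" "G ** (mat 1 + A ** Ab) = mat 1"
  using det_G by (simp_all add: matG_def matrix_inv_inverse)

text \<open>The push-through identity: it expresses the inverse of \<open>mat 1 + Ab ** A\<close> by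
  \<open>G\<close>, and also shows that this matrix is invertible.\<close>

lemma Gb_inverse: "(mat 1 + Ab ** A) ** (mat 1 - Ab ** G ** A) = mat 1"
proof -
  have "Ab ** ((mat 1 + A ** Ab) ** G) ** A = Ab ** A"
    by (simp add: G_inverse)
  then show ?thesis
    by (simp add: matrix_distribs)
qed

lemma Gb_eq: "Gb = mat 1 - Ab ** G ** A"
  unfolding matGb_def using Gb_inverse by (rule matrix_inv_eqI)

text \<open>In each entry the denominator \<open>lamb p $ j - lam p $ k\<close> cancels against
  \<open>inverse (lam p $ k) - inverse (lamb p $ j)\<close>, leaving a factor in \<open>j\<close>
  times a factor in \<open>k\<close>.\<close>

lemma AK: "A ** K = Kb ** A + outer (beta p) b"
  using lam_nz lamb_nz lamb_lam
  by (auto simp: vec_eq_iff diag_nth K_eq phase_eq matA_def beta_def row_b_def row_a_def outer_def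
      field_simps)

lemma AbKb: "Ab ** Kb = K ** Ab + outer (betab p) bb"
  using lam_nz lamb_nz lam_lamb
  by (auto simp: vec_eq_iff diag_nth K_eq phase_eq matAb_def betab_def row_bb_def row_ab_def outer_def
      field_simps)

text \<open>Moving \<open>Kb\<close> through \<open>A ** Ab\<close> costs one rank one term per
  factor. Multiplying by \<open>G\<close> on both sides carries this over to the inverse.\<close>

lemma commutator_Kb_G:
  "G ** Kb = Kb ** G - G ** A ** outer (betab p) bb ** G - G ** outer (beta p) b ** Ab ** G"
proof -
  have "A ** Ab ** Kb = A ** K ** Ab + A ** outer (betab p) bb"
    by (simp only: matrix_mul_assoc[symmetric] AbKb matrix_add_ldistrib)
  then have comm: "(mat 1 + A ** Ab) ** Kb
    = Kb ** (mat 1 + A ** Ab) + A ** outer (betab p) bb + outer (beta p) b ** Ab"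
    by (simp add: AK matrix_distribs)
  have cancel: "G ** (Kb ** (mat 1 + A ** Ab)) ** G = G ** Kb"
    by (simp add: matrix_mul_assoc[symmetric] G_inverse)
  have "Kb ** G = G ** ((mat 1 + A ** Ab) ** Kb) ** G"
    by (simp add: matrix_mul_assoc G_inverse)
  also have "\<dots> = G ** (Kb ** (mat 1 + A ** Ab) + A ** outer (betab p) bb + outer (beta p) b ** Ab) ** G"
    by (simp only: comm)
  also have "\<dots> = G ** (Kb ** (mat 1 + A ** Ab)) ** G + G ** (A ** outer (betab p) bb) ** G
      + G ** (outer (beta p) b ** Ab) ** G"
    by (simp only: matrix_add_ldistrib matrix_add_rdistrib)
  finally show ?thesis
    unfolding cancel by (simp add: matrix_mul_assoc)
qed

section \<open>Derivatives with respect to \<xi>\<close>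

lemma matA_derivative: "has_matrix_derivative (\<lambda>x. matA p x \<eta>) (A ** K) \<xi>"
  unfolding has_matrix_derivative_def matA_def phase_eq K_eq diag_nth
  using lamb_lam by (auto intro!: derivative_eq_intros)

lemma matAb_derivative: "has_matrix_derivative (\<lambda>x. matAb p x \<eta>) (- (Ab ** Kb)) \<xi>"
  unfolding has_matrix_derivative_def matAb_def phase_eq K_eq diag_nth vector_uminus_component
  using lam_lamb by (auto intro!: derivative_eq_intros)

lemma row_ab_derivative: "has_row_derivative (\<lambda>x. row_ab p x \<eta>) (- bb) \<xi>"
  unfolding has_row_derivative_def row_ab_def row_bb_def phase_eq K_eq diag_nth vector_uminus_component
  by (auto intro!: derivative_eq_intros)

lemma matG_derivative:
  "has_matrix_derivative (\<lambda>x. matG p x \<eta>) (G ** A ** outer (betab p) bb ** G) \<xi>"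
proof -
  \<comment> \<open>The product rule gives this difference; rewriting \<open>Ab ** Kb\<close> by
    \<open>AbKb\<close> cancels \<open>A ** K ** Ab\<close>.\<close>
  have "A ** K ** Ab + A ** (- (Ab ** Kb)) = - (A ** outer (betab p) bb)"
    by (simp add: AbKb matrix_distribs)
  then have "has_matrix_derivative (\<lambda>x. mat 1 + matA p x \<eta> ** matAb p x \<eta>)
      (- (A ** outer (betab p) bb)) \<xi>"
    using has_matrix_derivative_const_add[OF has_matrix_derivative_mult[OF matA_derivative matAb_derivative]]
    by simp
  from has_matrix_derivative_matrix_inv[OF this det_G] show ?thesis
    unfolding matG_def by (simp add: matrix_distribs)
qed

text \<open>The two sides are \<open>det G\<close> times the determinants of \<open>1 + A K Ab Lb\<close> and \<open>1 + Lb A K Ab\<close>.\<close>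

lemma u_alt: "u p \<xi> \<eta> = 1 + bracket b (Ab ** G) (alpha p)"
proof -
  let ?Lb = "matLb p"
  have KbL: "Kb ** ?Lb = mat 1" "?Lb ** Kb = mat 1"
    unfolding K_eq using lamb_nz by (simp_all add: matLb_def diag_mult mat_eq_diag)
  have bbL: "bb v* ?Lb = ab"
    by (simp add: row_bb_def vector_matrix_mul_assoc KbL)
  have Lbeta: "?Lb *v beta p = alpha p"
    by (simp add: beta_def matrix_vector_mul_assoc KbL)
  have "Ab ** (Kb ** ?Lb) = K ** Ab ** ?Lb + outer (betab p) bb ** ?Lb"
    by (simp add: matrix_mul_assoc AbKb matrix_add_rdistrib)
  then have Ab: "Ab - outer (betab p) ab = K ** Ab ** ?Lb"
    by (simp add: KbL outer_matrix bbL diff_eq_eq)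
  have "?Lb ** (A ** K) = (?Lb ** Kb) ** A + ?Lb ** outer (beta p) b"
    by (simp add: AK matrix_add_ldistrib matrix_mul_assoc)
  then have A: "A + outer (alpha p) b = ?Lb ** (A ** K)"
    by (simp add: KbL matrix_outer Lbeta)
  let ?X = "mat 1 + A ** K ** Ab ** ?Lb"
  let ?Y = "mat 1 + ?Lb ** (A ** K) ** Ab"
  have "mat 1 + outer (- (G ** A) *v betab p) ab = G ** (mat 1 + A ** Ab) - G ** A ** outer (betab p) ab"
    by (simp add: G_inverse matrix_outer[symmetric] matrix_minus_left)
  also have "\<dots> = G ** (mat 1 + A ** (Ab - outer (betab p) ab))"
    by (simp add: matrix_distribs)
  finally have 1: "mat 1 + outer (- (G ** A) *v betab p) ab = G ** ?X"
    by (simp add: Ab matrix_mul_assoc)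
  \<comment> \<open>\<open>?X\<close> and \<open>?Y\<close> are conjugate by the diagonal matrix
    \<open>?Lb\<close>, hence have equal determinants.\<close>
  have "?Lb ** ?X ** Kb = ?Y"
    by (simp add: matrix_add_ldistrib matrix_add_rdistrib KbL matrix_mul_assoc[symmetric])
  then have "det ?Y = det (?Lb ** ?X ** Kb)"
    by (simp only:)
  also have "\<dots> = det (?Lb ** Kb) * det ?X"
    by (simp only: det_mul mult_ac)
  finally have 2: "det ?X = det ?Y"
    by (simp only: KbL det_I mult_1_left)
  have "?Y ** G = (mat 1 + A ** Ab) ** G + outer (alpha p) b ** Ab ** G"
    by (simp only: A[symmetric] matrix_add_rdistrib add.assoc)
  then have "?Y ** G = mat 1 + outer (mat 1 *v alpha p) (b v* (Ab ** G))"
    by (simp add: G_inverse outer_matrix vector_matrix_mul_assoc)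
  then have 3: "det ?Y * det G = 1 + bracket b (Ab ** G) (alpha p)"
    by (simp only: det_mul[symmetric] det_one_plus_outer_bracket bracket_vector_matrix matrix_mul_rid)
  have "u p \<xi> \<eta> = det (mat 1 + outer (- (G ** A) *v betab p) ab)"
    by (simp only: u_def det_one_plus_outer_bracket bracket_linear) simp
  then show ?thesis
    by (simp only: 1 2 3[symmetric] det_mul mult.commute)
qed

text \<open>After \<open>A ** K\<close> and then \<open>G ** Kb\<close> are commuted, the
  \<open>Kb\<close> term cancels the derivative of the row, and one rank one term cancels the
  derivative of \<open>G\<close>. The remainder is \<open>G ** outer (beta p) b\<close> times
  \<open>mat 1 - Ab ** G ** A\<close>, which is \<open>Gb\<close>.\<close>

lemma u_derivative: "((\<lambda>x. u p x \<eta>) has_field_derivative - v p \<xi> \<eta> * w4 p \<xi> \<eta>) (at \<xi>)"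
proof -
  have "G ** A ** K = G ** Kb ** A + G ** outer (beta p) b"
    by (simp add: matrix_mul_assoc[symmetric] AK matrix_add_ldistrib)
  then have GAK: "G ** A ** K = Kb ** (G ** A) - G ** A ** outer (betab p) bb ** (G ** A)
      - G ** outer (beta p) b ** (Ab ** G ** A) + G ** outer (beta p) b"
    by (simp add: commutator_Kb_G matrix_diff_rdistrib matrix_mul_assoc)
  have "has_matrix_derivative (\<lambda>x. matG p x \<eta> ** matA p x \<eta>)
      (G ** A ** outer (betab p) bb ** (G ** A) + G ** A ** K) \<xi>"
    using has_matrix_derivative_mult[OF matG_derivative matA_derivative]
    by (simp add: matrix_mul_assoc)
  from has_field_derivative_bracket[OF row_ab_derivative this, of "betab p"]
  have "((\<lambda>x. u p x \<eta>) has_field_derivative - (bracket (- bb) (G ** A) (betab p)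
      + bracket ab (G ** A ** outer (betab p) bb ** (G ** A) + G ** A ** K) (betab p))) (at \<xi>)"
    unfolding u_def by (auto intro!: derivative_eq_intros)
  also have "- (bracket (- bb) (G ** A) (betab p)
      + bracket ab (G ** A ** outer (betab p) bb ** (G ** A) + G ** A ** K) (betab p))
    = - v p \<xi> \<eta> * w4 p \<xi> \<eta>"
    unfolding GAK w4_def Gb_eq v_def bracket_linear bracket_outer_mult bracket_outer_mult_end
      bracket_vector_matrix[of _ Kb, symmetric] row_bb_def[symmetric]
    by (simp add: algebra_simps)
  finally show ?thesis .
qed

text \<open>The column \<open>y\<close> stays free because \<open>v\<close> and \<open>w1\<close>
  differ only there: \<open>beta p\<close> gives the one, \<open>alpha p\<close> the other.\<close>

lemma bracket_G_derivative:
  "((\<lambda>x. bracket (row_ab p x \<eta>) (matG p x \<eta>) y) has_field_derivative - u p \<xi> \<eta> * bracket bb G y) (at \<xi>)"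
proof -
  have "bracket (- bb) G y + bracket ab (G ** A ** outer (betab p) bb ** G) y = - u p \<xi> \<eta> * bracket bb G y"
    unfolding u_def bracket_linear bracket_outer_mult by (simp add: algebra_simps)
  with has_field_derivative_bracket[OF row_ab_derivative matG_derivative, of y] show ?thesis
    by simp
qed

lemma v_derivative: "((\<lambda>x. v p x \<eta>) has_field_derivative - u p \<xi> \<eta> * w3 p \<xi> \<eta>) (at \<xi>)"
  unfolding v_def w3_def by (rule bracket_G_derivative)

lemma w1_derivative: "((\<lambda>x. w1 p x \<eta>) has_field_derivative - u p \<xi> \<eta> * v p \<xi> \<eta>) (at \<xi>)"
proof -
  have "v p \<xi> \<eta> = bracket ab (G ** Kb) (alpha p)"
    by (simp add: v_def beta_def bracket_matrix_vector)
  also have "\<dots> = bracket bb G (alpha p) - bracket ab (G ** A) (betab p) * bracket bb G (alpha p)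
      - v p \<xi> \<eta> * bracket b (Ab ** G) (alpha p)"
    unfolding commutator_Kb_G bracket_linear matrix_mul_assoc[of _ Ab, symmetric] bracket_outer_mult
      bracket_vector_matrix[of _ Kb, symmetric] row_bb_def[symmetric] v_def ..
  \<comment> \<open>The first two terms combine to \<open>u\<close> times the bracket with
    \<open>bb\<close>. With \<open>u_alt\<close> the right side becomes \<open>v\<close> times
    \<open>u\<close>, so no division by \<open>u\<close> occurs.\<close>
  finally have "u p \<xi> \<eta> * bracket bb G (alpha p) = v p \<xi> \<eta> * (1 + bracket b (Ab ** G) (alpha p))"
    by (simp add: u_def algebra_simps)
  then have "- u p \<xi> \<eta> * bracket bb G (alpha p) = - u p \<xi> \<eta> * v p \<xi> \<eta>"
    by (simp add: u_alt[symmetric] mult.commute)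
  with bracket_G_derivative[of "alpha p"] show ?thesis
    by (simp only: w1_def)
qed

text \<open>Membership in \<open>Omega\<close> for the exchanged data means that
  \<open>mat 1 + Ab ** A\<close> has nonzero determinant; the explicit right inverse provides
  this.\<close>

lemma soliton_point_swap_bar: "soliton_point (swap_bar p) (- \<xi>) (- \<eta>)"
proof
  have "det (mat 1 + Ab ** A) * det (mat 1 - Ab ** G ** A) = 1"
    by (simp only: det_mul[symmetric] Gb_inverse det_I)
  then show "(- \<xi>, - \<eta>) \<in> Omega (swap_bar p)"
    by (auto simp: Omega_def fields_swap_bar)
qed (use lam_nz lamb_nz lamb_lam in auto)

end

text \<open>The sign produced by negating \<xi> explains why the barred equations carry no minus
  sign.\<close>

lemma has_field_derivative_reflect:
  assumes "(f has_field_derivative - d) (at (- z))"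
  shows "((\<lambda>x. f (- x)) has_field_derivative d) (at (z :: complex))"
  using DERIV_chain2[OF assms DERIV_minus[OF DERIV_ident]] by simp

theorem proposition2p1:
  fixes p :: "('n::finite) soliton_data" and \<xi> \<eta> :: complex
  assumes "\<forall>j. lam p $ j \<noteq> 0"
    and "\<forall>j. lamb p $ j \<noteq> 0"
    and "\<forall>j k. lam p $ j \<noteq> lamb p $ k"
    and "(\<xi>, \<eta>) \<in> Omega p"
  shows
    "((\<lambda>x. u p x \<eta>) has_field_derivative - v p \<xi> \<eta> * w4 p \<xi> \<eta>) (at \<xi>) \<and>
     ((\<lambda>x. v p x \<eta>) has_field_derivative - u p \<xi> \<eta> * w3 p \<xi> \<eta>) (at \<xi>) \<and>
     ((\<lambda>x. w1 p x \<eta>) has_field_derivative - u p \<xi> \<eta> * v p \<xi> \<eta>) (at \<xi>) \<and>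
     ((\<lambda>x. ub p x \<eta>) has_field_derivative vb p \<xi> \<eta> * w3 p \<xi> \<eta>) (at \<xi>) \<and>
     ((\<lambda>x. vb p x \<eta>) has_field_derivative ub p \<xi> \<eta> * w4 p \<xi> \<eta>) (at \<xi>) \<and>
     ((\<lambda>x. w2 p x \<eta>) has_field_derivative ub p \<xi> \<eta> * vb p \<xi> \<eta>) (at \<xi>)"
proof -
  interpret soliton_point p \<xi> \<eta>
    using assms by unfold_locales
  \<comment> \<open>For the exchanged data \<open>u\<close>, \<open>v\<close>, \<open>w1\<close>,
    \<open>w3\<close>, \<open>w4\<close> at the negated point are \<open>ub\<close>,
    \<open>vb\<close>, \<open>w2\<close>, \<open>w4\<close>, \<open>w3\<close> at the original one,
    so the three derivatives already found become the remaining three after reflection.\<close>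
  interpret swap: soliton_point "swap_bar p" "- \<xi>" "- \<eta>"
    by (rule soliton_point_swap_bar)
  show ?thesis
    using u_derivative v_derivative w1_derivative
      has_field_derivative_reflect[of "\<lambda>x. u (swap_bar p) x (- \<eta>)" "vb p \<xi> \<eta> * w3 p \<xi> \<eta>" \<xi>]
      has_field_derivative_reflect[of "\<lambda>x. v (swap_bar p) x (- \<eta>)" "ub p \<xi> \<eta> * w4 p \<xi> \<eta>" \<xi>]
      has_field_derivative_reflect[of "\<lambda>x. w1 (swap_bar p) x (- \<eta>)" "ub p \<xi> \<eta> * vb p \<xi> \<eta>" \<xi>]
      swap.u_derivative swap.v_derivative swap.w1_derivative
    by (simp add: fields_swap_bar)
qed

end
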